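(* Let $\mathcal{C}$ be the class of finitely generated groups $G$ such that $\mathsf{Geo}(G,A)$ is piecewise excluding for every finite symmetric generating set $A$ of $G$. Then $\mathcal{C}$ is not closed under direct products; that is, there exist groups $G_1,G_2\in\mathcal{C}$ with $G_1\times G_2\notin\mathcal{C}$.
   Context: A generating set $A$ of a group $G$ is symmetric if it is inverse-closed: $A$ is a subset of $G$ generating $G$ and $a\in A$ implies $a^{-1}\in A$ (the identity element is allowed to belong to $A$). $A^*$ denotes the set of all finite words over the alphabet $A$, including the empty word. A word $w\in A^*$ is geodesic if it labels a path of minimal length between two vertices of the Cayley graph of $G$ over $A$; equivalently, no strictly shorter word over $A$ represents the same element of $G$ as $w$. The geodesic language $\mathsf{Geo}(G,A)\subseteq A^*$ is the set of all geodesic words. A word $a_1a_2\cdots a_n$ ($a_i\in A$) is a piecewise subword of $w\in A^*$ if $w=w_0a_1w_1a_2\cdots a_nw_n$ for some $w_i\in A^*$ (i.e. it is a not necessarily contiguous subsequence of $w$). A language $L\subseteq A^*$ is piecewise excluding if there is a finite set $F\subset A^*$ such that, for all $w\in A^*$, $w\in L$ if and only if $w$ contains no piecewise subword in $F$. *)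

theory Defs
  imports "HOL-Algebra.Algebra" "HOL-Library.Sublist"
begin

definition symmetric_generating_set :: "('a, 'b) monoid_scheme \<Rightarrow> 'a set \<Rightarrow> bool" where
  "symmetric_generating_set G A \<longleftrightarrow>
     A \<subseteq> carrier G \<and> generate G A = carrier G \<and> (\<forall>a\<in>A. inv\<^bsub>G\<^esub> a \<in> A)"

text \<open>The word \<open>w\<close> labels a path from \<open>g\<close> to \<open>h\<close> in the (right) Cayley graph of \<open>G\<close> over \<open>A\<close>,
  whose edges are \<open>g \<rightarrow> g a\<close> with label \<open>a \<in> A\<close>. Words over \<open>A\<close> are the elements of \<open>lists A\<close>,
  that is, lists of group elements.\<close>

fun cayley_path :: "('a, 'b) monoid_scheme \<Rightarrow> 'a set \<Rightarrow> 'a \<Rightarrow> 'a list \<Rightarrow> 'a \<Rightarrow> bool" where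
  "cayley_path G A g [] h \<longleftrightarrow> g \<in> carrier G \<and> h = g"
| "cayley_path G A g (a # w) h \<longleftrightarrow> g \<in> carrier G \<and> a \<in> A \<and> cayley_path G A (g \<otimes>\<^bsub>G\<^esub> a) w h"

definition geodesic_word :: "('a, 'b) monoid_scheme \<Rightarrow> 'a set \<Rightarrow> 'a list \<Rightarrow> bool" where
  "geodesic_word G A w \<longleftrightarrow>
     (\<exists>g h. cayley_path G A g w h \<and> (\<forall>v. cayley_path G A g v h \<longrightarrow> length w \<le> length v))"

definition Geo :: "('a, 'b) monoid_scheme \<Rightarrow> 'a set \<Rightarrow> 'a list set" where
  "Geo G A = {w \<in> lists A. geodesic_word G A w}"

text \<open>A piecewise subword is a not necessarily contiguous subsequence, which is \<^const>\<open>subseq\<close>.\<close>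

definition piecewise_excluding :: "'a set \<Rightarrow> 'a list set \<Rightarrow> bool" where
  "piecewise_excluding A L \<longleftrightarrow>
     L \<subseteq> lists A \<and>
     (\<exists>F. finite F \<and> F \<subseteq> lists A \<and>
          (\<forall>w\<in>lists A. w \<in> L \<longleftrightarrow> \<not> (\<exists>u\<in>F. subseq u w)))"

definition finitely_generated_group :: "('a, 'b) monoid_scheme \<Rightarrow> bool" where
  "finitely_generated_group G \<longleftrightarrow>
     group G \<and> (\<exists>S. finite S \<and> S \<subseteq> carrier G \<and> generate G S = carrier G)"

text \<open>The class is polymorphic in the carrier type. Since finitely generated groups are countable,
  each of them is isomorphic to a group whose carrier is a set of natural numbers, so quantifying
  over \<^typ>\<open>nat monoid\<close> loses no group of the class.\<close>

definition piecewise_excluding_group :: "('a, 'b) monoid_scheme \<Rightarrow> bool" where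
  "piecewise_excluding_group G \<longleftrightarrow>
     finitely_generated_group G \<and>
     (\<forall>A. finite A \<and> symmetric_generating_set G A \<longrightarrow> piecewise_excluding A (Geo G A))"

text \<open>The word-problem description of geodesics: no strictly shorter word over \<open>A\<close> represents the
  same group element. The element represented by a word \<open>w\<close> is \<open>foldr (\<otimes>) w \<one>\<close>.\<close>

lemma cayley_path_iff:
  assumes "group G" "A \<subseteq> carrier G" "g \<in> carrier G"
  shows "cayley_path G A g w h \<longleftrightarrow> w \<in> lists A \<and> h = g \<otimes>\<^bsub>G\<^esub> foldr (\<otimes>\<^bsub>G\<^esub>) w \<one>\<^bsub>G\<^esub>"
proof -
  interpret group G by fact
  show ?thesis
    using assms(3)
  proof (induction w arbitrary: g)
    case Nil
    then show ?case by simp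
  next
    case (Cons a w)
    show ?case
    proof (cases "a \<in> A \<and> w \<in> lists A")
      case True
      then have "a \<in> carrier G" "set w \<subseteq> carrier G" using assms(2) by auto
      then show ?thesis using Cons True by (simp add: m_assoc)
    next
      case False
      have "\<not> cayley_path G A (g \<otimes>\<^bsub>G\<^esub> a) w h" if "a \<in> A"
        using False Cons.IH[of "g \<otimes>\<^bsub>G\<^esub> a"] Cons.prems that assms(2) by blast
      then show ?thesis using False by auto
    qed
  qed
qed

lemma geodesic_word_iff:
  assumes "group G" "A \<subseteq> carrier G"
  shows "geodesic_word G A w \<longleftrightarrow>
    w \<in> lists A \<and>
    \<not> (\<exists>v\<in>lists A. length v < length w \<and>
          foldr (\<otimes>\<^bsub>G\<^esub>) v \<one>\<^bsub>G\<^esub> = foldr (\<otimes>\<^bsub>G\<^esub>) w \<one>\<^bsub>G\<^esub>)"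
proof -
  interpret group G by fact
  have closed: "foldr (\<otimes>\<^bsub>G\<^esub>) v \<one>\<^bsub>G\<^esub> \<in> carrier G" if "v \<in> lists A" for v
    using that assms(2) by (intro multlist_closed) auto
  have start: "g \<in> carrier G" if "cayley_path G A g v h" for g v h
    using that by (cases v) auto
  show ?thesis
  proof
    assume "geodesic_word G A w"
    then obtain g h where p: "cayley_path G A g w h"
      and m: "\<And>v. cayley_path G A g v h \<Longrightarrow> length w \<le> length v"
      unfolding geodesic_word_def by blast
    note iff = cayley_path_iff[OF assms start[OF p]]
    show "w \<in> lists A \<and> \<not> (\<exists>v\<in>lists A. length v < length w \<and>
        foldr (\<otimes>\<^bsub>G\<^esub>) v \<one>\<^bsub>G\<^esub> = foldr (\<otimes>\<^bsub>G\<^esub>) w \<one>\<^bsub>G\<^esub>)"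
      using p m unfolding iff by (metis not_le)
  next
    assume *: "w \<in> lists A \<and> \<not> (\<exists>v\<in>lists A. length v < length w \<and>
        foldr (\<otimes>\<^bsub>G\<^esub>) v \<one>\<^bsub>G\<^esub> = foldr (\<otimes>\<^bsub>G\<^esub>) w \<one>\<^bsub>G\<^esub>)"
    show "geodesic_word G A w"
      unfolding geodesic_word_def
    proof (intro exI conjI allI impI)
      show "cayley_path G A \<one>\<^bsub>G\<^esub> w (\<one>\<^bsub>G\<^esub> \<otimes>\<^bsub>G\<^esub> foldr (\<otimes>\<^bsub>G\<^esub>) w \<one>\<^bsub>G\<^esub>)"
        using * by (simp add: cayley_path_iff[OF assms])
      fix v
      assume "cayley_path G A \<one>\<^bsub>G\<^esub> v (\<one>\<^bsub>G\<^esub> \<otimes>\<^bsub>G\<^esub> foldr (\<otimes>\<^bsub>G\<^esub>) w \<one>\<^bsub>G\<^esub>)"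
      then have "v \<in> lists A" "foldr (\<otimes>\<^bsub>G\<^esub>) v \<one>\<^bsub>G\<^esub> = foldr (\<otimes>\<^bsub>G\<^esub>) w \<one>\<^bsub>G\<^esub>"
        using * closed by (auto simp: cayley_path_iff[OF assms])
      then show "length w \<le> length v"
        using * by (metis not_le)
    qed
  qed
qed

end

(* A word of length at most 2 has only contiguous piecewise subwords, so a group all of whose Cayley
   graphs have diameter at most 2 lies in the class: the finitely many non-geodesic words of length
   at most 3 are enough to exclude. Every symmetric generating set of the quaternion group contains
   two of the pairs {i,-i}, {j,-j}, {k,-k}, so its Cayley graphs have diameter at most 2; those of Z/3 have
   diameter 1. In the product take the generators a = (i,0), b = (j,1) and their inverses: the word
   a b a^-1 represents (-j,1) and is geodesic, but its piecewise subword a a^-1 is not. *)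

theory Submission
  imports Defs
begin

section \<open>Geodesics in Cayley graphs of diameter at most two\<close>

lemma Geo_iff:
  assumes "group G" "A \<subseteq> carrier G"
  shows "w \<in> Geo G A \<longleftrightarrow> w \<in> lists A \<and>
    (\<forall>v\<in>lists A. foldr (\<otimes>\<^bsub>G\<^esub>) v \<one>\<^bsub>G\<^esub> = foldr (\<otimes>\<^bsub>G\<^esub>) w \<one>\<^bsub>G\<^esub> \<longrightarrow> length w \<le> length v)"
  unfolding Geo_def mem_Collect_eq geodesic_word_iff[OF assms] by (meson not_le)

lemma subseq_of_short:
  assumes "subseq u w" "length w \<le> 2"
  shows "u = w \<or> length u = 0 \<or> (length u = 1 \<and> set u \<subseteq> set w \<and> length w = 2)"
proof -
  have "length u \<le> length w" "set u \<subseteq> set w"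
    using assms(1) by (auto simp: list_emb_length dest: list_emb_set)
  moreover have "length u = length w \<Longrightarrow> u = w"
    using assms(1) by (simp add: subseq_same_length)
  ultimately show ?thesis
    using assms(2) by linarith
qed

text \<open>The diameter bound forces geodesics to have length at most 2. At that length only single
  letters of two-letter words need checking to see that subwords of geodesics are geodesic.
  Conversely, a non-geodesic word has a non-geodesic prefix of length at most 3.\<close>

lemma piecewise_excluding_if_diameter_le_2:
  assumes G: "group G" and A: "A \<subseteq> carrier G" "finite A"
    and diam: "\<And>g. g \<in> carrier G \<Longrightarrow>
      \<exists>v\<in>lists A. length v \<le> 2 \<and> foldr (\<otimes>\<^bsub>G\<^esub>) v \<one>\<^bsub>G\<^esub> = g"
  shows "piecewise_excluding A (Geo G A)"
proof -
  interpret group G by fact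
  note iff = Geo_iff[OF G A(1)]
  have closed: "foldr (\<otimes>\<^bsub>G\<^esub>) v \<one>\<^bsub>G\<^esub> \<in> carrier G" if "v \<in> lists A" for v
    using that A(1) by (intro multlist_closed) auto
  have short: "length w \<le> 2" if "w \<in> Geo G A" for w
  proof -
    have "w \<in> lists A" using that iff by blast
    then obtain v where "v \<in> lists A" "length v \<le> 2"
      "foldr (\<otimes>\<^bsub>G\<^esub>) v \<one>\<^bsub>G\<^esub> = foldr (\<otimes>\<^bsub>G\<^esub>) w \<one>\<^bsub>G\<^esub>"
      using diam closed by metis
    then show ?thesis
      using that iff by fastforce
  qed
  have sub: "u \<in> Geo G A" if w: "w \<in> Geo G A" and u: "subseq u w" for u w
  proof -
    have wA: "w \<in> lists A"
      using w iff by blast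
    \<comment> \<open>A trivial letter could be deleted from \<open>[b, c]\<close>, leaving a
      shorter word for the same element. So both letters are nontrivial, and a nontrivial letter is
      geodesic on its own.\<close>
    have single: "[a] \<in> Geo G A" if "length w = 2" "a \<in> set w" for a
    proof -
      obtain b c where bc: "w = [b, c]"
        using \<open>length w = 2\<close> by (auto simp: length_Suc_conv numeral_2_eq_2)
      then have bcA: "b \<in> A" "c \<in> A" "b \<in> carrier G" "c \<in> carrier G"
        using wA A(1) by auto
      have "b \<noteq> \<one>\<^bsub>G\<^esub>"
      proof
        assume "b = \<one>\<^bsub>G\<^esub>"
        then show False
          using w bc bcA iff[of w] by (auto dest!: bspec[where x = "[c]"])
      qed
      moreover have "c \<noteq> \<one>\<^bsub>G\<^esub>"
      proof
        assume "c = \<one>\<^bsub>G\<^esub>"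
        then show False
          using w bc bcA iff[of w] by (auto dest!: bspec[where x = "[b]"])
      qed
      ultimately have "a \<noteq> \<one>\<^bsub>G\<^esub>" "a \<in> A" "a \<in> carrier G"
        using \<open>a \<in> set w\<close> bc bcA by auto
      moreover have "1 \<le> length v" if "foldr (\<otimes>\<^bsub>G\<^esub>) v \<one>\<^bsub>G\<^esub> = a" for v
        using that \<open>a \<noteq> \<one>\<^bsub>G\<^esub>\<close> by (cases v) auto
      ultimately show ?thesis
        unfolding iff by simp
    qed
    consider "u = w" | "u = []" | a where "u = [a]" "a \<in> set w" "length w = 2"
      using subseq_of_short[OF u short[OF w]] by (auto simp: length_Suc_conv)
    then show ?thesis
      using w single by cases (auto simp: iff)
  qed
  \<comment> \<open>The bound 3 is one more than the diameter bound, so \<open>F\<close> contains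
    every word of length exactly 3.\<close>
  define F where "F = {w \<in> lists A. length w \<le> 3} - Geo G A"
  have "finite F"
    unfolding F_def using finite_lists_length_le[OF A(2), of 3]
    by (rule_tac finite_Diff) (simp add: lists_eq_set conj_commute)
  moreover have "w \<in> Geo G A \<longleftrightarrow> \<not> (\<exists>u\<in>F. subseq u w)" if w: "w \<in> lists A" for w
  proof
    assume "w \<in> Geo G A"
    then show "\<not> (\<exists>u\<in>F. subseq u w)"
      using sub F_def by blast
  next
    assume *: "\<not> (\<exists>u\<in>F. subseq u w)"
    show "w \<in> Geo G A"
    proof (rule ccontr)
      assume not: "w \<notin> Geo G A"
      \<comment> \<open>This prefix is either \<open>w\<close> itself or a word of length exactly 3,
        too long to be geodesic.\<close>
      have "take 3 w \<notin> Geo G A"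
        using not short[of "take 3 w"] by (cases "length w \<le> 3") auto
      moreover have "take 3 w \<in> lists A"
        using w by (auto dest: in_set_takeD)
      ultimately have "take 3 w \<in> F"
        unfolding F_def by simp
      moreover have "subseq (take 3 w) w"
        by (metis append_take_drop_id list_emb_prefix subseq_order.refl)
      ultimately show False
        using * by blast
    qed
  qed
  moreover have "Geo G A \<subseteq> lists A" "F \<subseteq> lists A"
    unfolding F_def Geo_def by auto
  ultimately show ?thesis
    unfolding piecewise_excluding_def by blast
qed

section \<open>The quaternion group and the cyclic group of order three\<close>

text \<open>The elements 1, -1, i, -i, j, -j, k, -k are numbered from 0 to 7 in this order.\<close>

definition quaternion_mult :: "nat \<Rightarrow> nat \<Rightarrow> nat" where
  "quaternion_mult x y =
    [[0, 1, 2, 3, 4, 5, 6, 7],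
     [1, 0, 3, 2, 5, 4, 7, 6],
     [2, 3, 1, 0, 6, 7, 5, 4],
     [3, 2, 0, 1, 7, 6, 4, 5],
     [4, 5, 7, 6, 1, 0, 2, 3],
     [5, 4, 6, 7, 0, 1, 3, 2],
     [6, 7, 4, 5, 3, 2, 1, 0],
     [7, 6, 5, 4, 2, 3, 0, 1]] ! x ! y"

definition quaternion_group :: "nat monoid" where
  "quaternion_group = \<lparr>carrier = {..<8}, monoid.mult = quaternion_mult, one = 0\<rparr>"

definition cyclic_group_3 :: "nat monoid" where
  "cyclic_group_3 = \<lparr>carrier = {..<3}, monoid.mult = (\<lambda>x y. (x + y) mod 3), one = 0\<rparr>"

lemma quaternion_simps [simp]:
  "carrier quaternion_group = {..<8}"
  "x \<otimes>\<^bsub>quaternion_group\<^esub> y = quaternion_mult x y"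
  "\<one>\<^bsub>quaternion_group\<^esub> = 0"
  by (simp_all add: quaternion_group_def)

lemma cyclic_3_simps [simp]:
  "carrier cyclic_group_3 = {..<3}"
  "x \<otimes>\<^bsub>cyclic_group_3\<^esub> y = (x + y) mod 3"
  "\<one>\<^bsub>cyclic_group_3\<^esub> = 0"
  by (simp_all add: cyclic_group_3_def)

text \<open>Each axiom is a bounded statement about the multiplication table and is decided by
  evaluation.\<close>

lemma group_quaternion: "group quaternion_group"
proof (rule groupI)
  have "\<forall>x\<in>{..<8}. \<forall>y\<in>{..<8}. quaternion_mult x y < 8"
    by code_simp
  then show "x \<otimes>\<^bsub>quaternion_group\<^esub> y \<in> carrier quaternion_group"
    if "x \<in> carrier quaternion_group" "y \<in> carrier quaternion_group" for x y
    using that by simp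
  have "\<forall>x\<in>{..<8}. \<forall>y\<in>{..<8}. \<forall>z\<in>{..<8}.
      quaternion_mult (quaternion_mult x y) z = quaternion_mult x (quaternion_mult y z)"
    by code_simp
  then show "x \<otimes>\<^bsub>quaternion_group\<^esub> y \<otimes>\<^bsub>quaternion_group\<^esub> z
      = x \<otimes>\<^bsub>quaternion_group\<^esub> (y \<otimes>\<^bsub>quaternion_group\<^esub> z)"
    if "x \<in> carrier quaternion_group" "y \<in> carrier quaternion_group" "z \<in> carrier quaternion_group"
    for x y z
    using that by simp
  have "\<forall>x\<in>{..<8}. quaternion_mult 0 x = x"
    by code_simp
  then show "\<one>\<^bsub>quaternion_group\<^esub> \<otimes>\<^bsub>quaternion_group\<^esub> x = x" if "x \<in> carrier quaternion_group" for x
    using that by simp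
  have "\<forall>x\<in>{..<8}. \<exists>y\<in>{..<8}. quaternion_mult y x = 0"
    by code_simp
  then show "\<exists>y\<in>carrier quaternion_group. y \<otimes>\<^bsub>quaternion_group\<^esub> x = \<one>\<^bsub>quaternion_group\<^esub>"
    if "x \<in> carrier quaternion_group" for x
    using that by simp
qed simp

lemma group_cyclic_3: "group cyclic_group_3"
proof (rule groupI)
  fix x
  assume "x \<in> carrier cyclic_group_3"
  then show "\<exists>y\<in>carrier cyclic_group_3. y \<otimes>\<^bsub>cyclic_group_3\<^esub> x = \<one>\<^bsub>cyclic_group_3\<^esub>"
    \<comment> \<open>The outer \<open>mod\<close> matters at \<open>x = 0\<close>, where
      \<open>3 - x\<close> lies outside the carrier.\<close>
    by (intro bexI[of _ "(3 - x) mod 3"]) (auto simp: mod_add_left_eq)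
qed (auto simp: mod_add_left_eq mod_add_right_eq add.assoc)

lemma inv_quaternion:
  assumes "x < 8" "y < 8" "quaternion_mult x y = 0"
  shows "inv\<^bsub>quaternion_group\<^esub> x = y"
  \<comment> \<open>The assumption gives a right inverse, while \<open>inv_equality\<close> asks for
    a left one; \<open>inv_comm\<close> converts between them.\<close>
  using group.inv_equality[OF group_quaternion, of y x]
    group.inv_comm[OF group_quaternion, of x y] assms by simp

lemma inv_cyclic_3:
  assumes "x < 3" "y < 3" "(x + y) mod 3 = 0"
  shows "inv\<^bsub>cyclic_group_3\<^esub> x = y"
  using group.inv_equality[OF group_cyclic_3, of y x] assms by (simp add: add.commute)

lemma less_8_cases:
  fixes x :: nat
  assumes "x < 8"
  shows "x = 0 \<or> x = 1 \<or> x = 2 \<or> x = 3 \<or> x = 4 \<or> x = 5 \<or> x = 6 \<or> x = 7"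
  using assms by arith

text \<open>The inverse of -1 is listed for both \<open>1\<close> and \<open>Suc 0\<close>, because
  the simplifier rewrites the former to the latter.\<close>

lemma inv_quaternion_eval:
  "inv\<^bsub>quaternion_group\<^esub> 0 = 0"
  "inv\<^bsub>quaternion_group\<^esub> 1 = 1"
  "inv\<^bsub>quaternion_group\<^esub> (Suc 0) = 1"
  "inv\<^bsub>quaternion_group\<^esub> 2 = 3"
  "inv\<^bsub>quaternion_group\<^esub> 3 = 2"
  "inv\<^bsub>quaternion_group\<^esub> 4 = 5"
  "inv\<^bsub>quaternion_group\<^esub> 5 = 4"
  "inv\<^bsub>quaternion_group\<^esub> 6 = 7"
  "inv\<^bsub>quaternion_group\<^esub> 7 = 6"
  by (rule inv_quaternion; simp add: quaternion_mult_def)+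

section \<open>Generating sets and diameter of the quaternion group\<close>

text \<open>The codes 2, 4, 6 stand for i, j, k, and \<open>c + 1\<close> is the negative of
  \<open>c\<close>. The set is thus the cyclic subgroup of order 4 generated by \<open>c\<close>, a
  proper subgroup that cannot contain a generating set.\<close>

lemma quaternion_subgroup:
  assumes "c \<in> {2, 4, 6}"
  shows "subgroup {0, 1, c, c + 1} quaternion_group"
proof (rule group.subgroupI[OF group_quaternion])
  show "inv\<^bsub>quaternion_group\<^esub> a \<in> {0, 1, c, c + 1}" if "a \<in> {0, 1, c, c + 1}" for a
    using assms that by (auto simp: inv_quaternion_eval)
  have "\<forall>c\<in>{2, 4, 6}. \<forall>a\<in>{0, 1, c, c + 1}. \<forall>b\<in>{0, 1, c, c + 1}.
      quaternion_mult a b \<in> {0, 1, c, c + 1}"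
    by code_simp
  then show "a \<otimes>\<^bsub>quaternion_group\<^esub> b \<in> {0, 1, c, c + 1}"
    if "a \<in> {0, 1, c, c + 1}" "b \<in> {0, 1, c, c + 1}" for a b
    using that assms by (metis quaternion_simps(2))
qed (use assms in auto)

text \<open>Some generator lies outside the proper subgroup {1, -1, c, -c}. It is d or -d for
  another unit d, and closure under inverses supplies the other sign.\<close>

lemma quaternion_generators_escape:
  assumes A: "symmetric_generating_set quaternion_group A" and c: "c \<in> {2, 4, 6}"
  shows "\<exists>d\<in>{2, 4, 6}. d \<noteq> c \<and> {d, d + 1} \<subseteq> A"
proof -
  have gen: "A \<subseteq> {..<8}" "generate quaternion_group A = {..<8}"
    and sym: "\<And>a. a \<in> A \<Longrightarrow> inv\<^bsub>quaternion_group\<^esub> a \<in> A"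
    using A unfolding symmetric_generating_set_def by auto
  have "\<not> A \<subseteq> {0, 1, c, c + 1}"
  proof
    assume "A \<subseteq> {0, 1, c, c + 1}"
    then have "{..<8} \<subseteq> {0, 1, c, c + 1}"
      using group.generate_subgroup_incl[OF group_quaternion _ quaternion_subgroup[OF c]] gen(2)
      by metis
    then have "card {..<8::nat} \<le> card {0, 1, c, c + 1}"
      by (intro card_mono) auto
    then show False
      using c by auto
  qed
  then obtain x where x: "x \<in> A" "x \<notin> {0, 1, c, c + 1}"
    by blast
  then have "x < 8" using gen(1) by auto
  from less_8_cases[OF this] show ?thesis
    using x c sym[OF x(1)] by (elim disjE) (auto simp: inv_quaternion_eval)
qed

text \<open>Two pairs of units c, -c and d, -d suffice: the empty word gives 1, the square of c
  gives -1, and products of c or -c with d give the third unit with both signs.\<close>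

lemma quaternion_diameter_le_2:
  assumes A: "symmetric_generating_set quaternion_group A" and g: "g \<in> carrier quaternion_group"
  shows "\<exists>v\<in>lists A. length v \<le> 2 \<and>
    foldr (\<otimes>\<^bsub>quaternion_group\<^esub>) v \<one>\<^bsub>quaternion_group\<^esub> = g"
proof -
  \<comment> \<open>\<open>foldr\<close> ends every nonempty word with a multiplication by the
    identity on the right.\<close>
  have right_one: "quaternion_mult x 0 = x" if "x \<in> A" for x
    using group.is_monoid[OF group_quaternion, THEN monoid.r_one, of x] that A
    unfolding symmetric_generating_set_def by auto
  obtain c where c: "c \<in> {2, 4, 6}" "{c, c + 1} \<subseteq> A"
    \<comment> \<open>The value 2 is an arbitrary start. Avoiding it gives a first pair, and
      avoiding that pair then gives a second one.\<close>
    using quaternion_generators_escape[OF A, of 2] by blast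
  obtain d where d: "d \<in> {2, 4, 6}" "d \<noteq> c" "{d, d + 1} \<subseteq> A"
    using quaternion_generators_escape[OF A c(1)] by blast
  have "\<forall>c\<in>{2, 4, 6}. \<forall>d\<in>{2, 4, 6}. d \<noteq> c \<longrightarrow> (\<forall>g\<in>{..<8}.
      g = 0 \<or> g \<in> {c, c + 1, d, d + 1} \<or>
      (\<exists>a\<in>{c, c + 1, d, d + 1}. \<exists>b\<in>{c, c + 1, d, d + 1}. g = quaternion_mult a b))"
    by code_simp
  then have "g = 0 \<or> g \<in> {c, c + 1, d, d + 1} \<or>
      (\<exists>a\<in>{c, c + 1, d, d + 1}. \<exists>b\<in>{c, c + 1, d, d + 1}. g = quaternion_mult a b)"
    using c(1) d(1,2) g unfolding quaternion_simps by metis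
  moreover have "{c, c + 1, d, d + 1} \<subseteq> A"
    using c d by blast
  ultimately consider "g = 0" | "g \<in> A" | a b where "a \<in> A" "b \<in> A" "g = quaternion_mult a b"
    by blast
  then show ?thesis
  proof cases
    case 1
    then show ?thesis by (intro bexI[of _ "[]"]) auto
  next
    case 2
    then show ?thesis by (intro bexI[of _ "[g]"]) (auto simp: right_one)
  next
    case 3
    then show ?thesis by (intro bexI[of _ "[a, b]"]) (auto simp: right_one)
  qed
qed

lemma finitely_generated_group_if_finite:
  assumes "group G" "finite (carrier G)"
  shows "finitely_generated_group G"
proof -
  have "generate G (carrier G) = carrier G"
    using group.generate_incl[OF assms(1), of "carrier G"] generate.incl[of _ "carrier G" G] by blast
  then show ?thesis
    using assms unfolding finitely_generated_group_def by blast
qed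

lemma piecewise_excluding_group_quaternion: "piecewise_excluding_group quaternion_group"
  unfolding piecewise_excluding_group_def
proof (intro conjI allI impI)
  show "finitely_generated_group quaternion_group"
    by (rule finitely_generated_group_if_finite[OF group_quaternion]) simp
  fix A
  assume "finite A \<and> symmetric_generating_set quaternion_group A"
  then show "piecewise_excluding A (Geo quaternion_group A)"
    using quaternion_diameter_le_2
    by (intro piecewise_excluding_if_diameter_le_2[OF group_quaternion])
      (auto simp only: symmetric_generating_set_def)
qed

section \<open>Generating sets of the cyclic group of order three\<close>

text \<open>Some generator is nontrivial, and it and its inverse are all the nontrivial elements.
  Every element is therefore reached by a word of length at most one.\<close>

lemma cyclic_3_generators:
  assumes "symmetric_generating_set cyclic_group_3 A"
  shows "{1, 2} \<subseteq> A"
proof -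
  have gen: "A \<subseteq> {..<3}" "generate cyclic_group_3 A = {..<3}"
    and sym: "\<And>a. a \<in> A \<Longrightarrow> inv\<^bsub>cyclic_group_3\<^esub> a \<in> A"
    using assms unfolding symmetric_generating_set_def by auto
  have "\<not> A \<subseteq> {0}"
  proof
    assume "A \<subseteq> {0}"
    then have "{..<3} \<subseteq> {0::nat}"
      using group.generate_subgroup_incl[OF group_cyclic_3 _ group.triv_subgroup[OF group_cyclic_3]]
        gen(2) by (metis cyclic_3_simps(3))
    then have "(1::nat) \<in> {0}" by (rule subsetD) simp
    then show False by simp
  qed
  then obtain x where "x \<in> A" "x \<noteq> 0" by blast
  then have "x = 1 \<or> x = 2" using gen(1) by auto
  moreover have "inv\<^bsub>cyclic_group_3\<^esub> 1 = 2" "inv\<^bsub>cyclic_group_3\<^esub> 2 = 1"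
    by (rule inv_cyclic_3; simp)+
  ultimately show ?thesis
    using sym[OF \<open>x \<in> A\<close>] \<open>x \<in> A\<close> by auto
qed

lemma piecewise_excluding_group_cyclic_3: "piecewise_excluding_group cyclic_group_3"
  unfolding piecewise_excluding_group_def
proof (intro conjI allI impI)
  show "finitely_generated_group cyclic_group_3"
    by (rule finitely_generated_group_if_finite[OF group_cyclic_3]) simp
  fix A
  assume A: "finite A \<and> symmetric_generating_set cyclic_group_3 A"
  show "piecewise_excluding A (Geo cyclic_group_3 A)"
  proof (rule piecewise_excluding_if_diameter_le_2[OF group_cyclic_3])
    show "finite A" "A \<subseteq> carrier cyclic_group_3"
      using A by (auto simp only: symmetric_generating_set_def)
    fix g
    assume g: "g \<in> carrier cyclic_group_3"
    show "\<exists>v\<in>lists A. length v \<le> 2 \<and>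
      foldr (\<otimes>\<^bsub>cyclic_group_3\<^esub>) v \<one>\<^bsub>cyclic_group_3\<^esub> = g"
    proof (cases "g = 0")
      case True
      then show ?thesis by (intro bexI[of _ "[]"]) auto
    next
      case False
      then have "g = 1 \<or> g = 2" using g by auto
      then show ?thesis
        using cyclic_3_generators A by (intro bexI[of _ "[g]"]) auto
    qed
  qed
qed

section \<open>Failure for the direct product\<close>

text \<open>An excluded word inside \<open>u\<close> would also be inside \<open>w\<close>. Hence
  one geodesic with a non-geodesic piecewise subword refutes the property.\<close>

lemma piecewise_excluding_subseq_closed:
  assumes "piecewise_excluding A L" "w \<in> L" "subseq u w"
  shows "u \<in> L"
proof -
  obtain F where "L \<subseteq> lists A"
    and F: "\<forall>w\<in>lists A. w \<in> L \<longleftrightarrow> \<not> (\<exists>u\<in>F. subseq u w)"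
    using assms(1) unfolding piecewise_excluding_def by blast
  then have w: "w \<in> lists A"
    using assms(2) by blast
  then have "u \<in> lists A"
    using list_emb_set[OF assms(3)] by (metis in_lists_conv_set)
  moreover have "\<not> subseq x u" if "x \<in> F" for x
    using F w that assms(2) subseq_order.trans[OF _ assms(3)] by blast
  ultimately show ?thesis
    using F by blast
qed

lemma group_product: "group (quaternion_group \<times>\<times> cyclic_group_3)"
  by (rule DirProd_group[OF group_quaternion group_cyclic_3])

text \<open>In order: a = (i,0), its inverse, b = (j,1) and its inverse (-j,2). Coupling j to 1
  keeps (-j,1) from being a letter.\<close>

abbreviation product_generators :: "(nat \<times> nat) set" where
  "product_generators \<equiv> {(2, 0), (3, 0), (4, 1), (5, 2)}"

lemma product_generators_subset:
  "product_generators \<subseteq> carrier (quaternion_group \<times>\<times> cyclic_group_3)"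
  by auto

lemma symmetric_generating_set_product:
  "symmetric_generating_set (quaternion_group \<times>\<times> cyclic_group_3) product_generators"
proof -
  let ?P = "quaternion_group \<times>\<times> cyclic_group_3"
  let ?H = "generate ?P product_generators"
  have mult: "(quaternion_mult a c, (b + d) mod 3) \<in> ?H" if "(a, b) \<in> ?H" "(c, d) \<in> ?H" for a b c d
    using generate.eng[OF that] by simp
  have gens: "(2, 0) \<in> ?H" "(3, 0) \<in> ?H" "(4, 1) \<in> ?H" "(5, 2) \<in> ?H"
    by (intro generate.incl; simp)+
  \<comment> \<open>The coordinates of b have coprime orders 4 and 3, so powers of b separate them:
    its square is (-1,2) and its fourth power is (1,1). This yields the second factor, then (j,0),
    which together with (i,0) generates the first.\<close>
  have j2: "(1, 2) \<in> ?H" using mult[OF gens(3) gens(3)] by (simp add: quaternion_mult_def numeral_2_eq_2)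
  have z1: "(0, 1) \<in> ?H" using mult[OF j2 j2] by (simp add: quaternion_mult_def numeral_2_eq_2)
  have z2: "(0, 2) \<in> ?H" using mult[OF z1 z1] by (simp add: quaternion_mult_def numeral_2_eq_2)
  have q0: "(0, 0) \<in> ?H" using mult[OF z1 z2] by (simp add: quaternion_mult_def numeral_2_eq_2)
  have q1: "(1, 0) \<in> ?H" using mult[OF j2 z1] by (simp add: quaternion_mult_def numeral_2_eq_2)
  have q4: "(4, 0) \<in> ?H" using mult[OF gens(3) z2] by (simp add: quaternion_mult_def numeral_2_eq_2)
  have q5: "(5, 0) \<in> ?H" using mult[OF gens(4) z1] by (simp add: quaternion_mult_def numeral_2_eq_2)
  have q6: "(6, 0) \<in> ?H" using mult[OF gens(1) q4] by (simp add: quaternion_mult_def numeral_2_eq_2)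
  have q7: "(7, 0) \<in> ?H" using mult[OF gens(1) q5] by (simp add: quaternion_mult_def numeral_2_eq_2)
  have q: "(x, 0) \<in> ?H" if "x < 8" for x
    using less_8_cases[OF that] by (elim disjE) (simp_all only: q0 q1 gens q4 q5 q6 q7)
  have z: "(0, y) \<in> ?H" if "y < 3" for y
  proof -
    have "y = 0 \<or> y = 1 \<or> y = 2" using that by arith
    then show ?thesis by (elim disjE) (simp_all only: q0 z1 z2)
  qed
  have "(x, y) \<in> ?H" if "x < 8" "y < 3" for x y
    using mult[OF q[OF that(1)] z[OF that(2)]] that
      group.is_monoid[OF group_quaternion, THEN monoid.r_one, of x] by simp
  then have "carrier ?P \<subseteq> ?H" by (intro subsetI) (auto simp only: DirProd_def partial_object.simps
      quaternion_simps cyclic_3_simps lessThan_iff)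
  moreover have "?H \<subseteq> carrier ?P"
    by (rule group.generate_incl[OF group_product product_generators_subset])
  moreover have "inv\<^bsub>?P\<^esub> a \<in> product_generators" if "a \<in> product_generators" for a
    using that
    by (elim insertE emptyE)
      (simp_all add: inv_DirProd[OF group_quaternion group_cyclic_3] inv_quaternion_eval inv_cyclic_3)
  ultimately show ?thesis
    unfolding symmetric_generating_set_def
    using product_generators_subset by (intro conjI ballI equalityI)
qed

lemma not_piecewise_excluding_product:
  "\<not> piecewise_excluding product_generators
    (Geo (quaternion_group \<times>\<times> cyclic_group_3) product_generators)"
proof
  let ?P = "quaternion_group \<times>\<times> cyclic_group_3"
  let ?L = "Geo ?P product_generators"
  assume pe: "piecewise_excluding product_generators ?L"
  note iff = Geo_iff[OF group_product product_generators_subset]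
  \<comment> \<open>This is a b a^-1: conjugating j by i gives -j, with code 5.\<close>
  have eval: "foldr (\<otimes>\<^bsub>?P\<^esub>) [(2, 0), (4, 1), (3, 0)] \<one>\<^bsub>?P\<^esub> = (5, 1)"
    by (simp add: quaternion_mult_def)
  \<comment> \<open>With at most two letters, second coordinate 1 arises only from b alone, from b
    with one a or a^-1, or from b^-1 twice. The first coordinates are then j, k or -k, and -1, never
    -j. The proof checks all these short words directly.\<close>
  have "3 \<le> length v"
    if v: "v \<in> lists product_generators" and e: "foldr (\<otimes>\<^bsub>?P\<^esub>) v \<one>\<^bsub>?P\<^esub> = (5, 1)" for v
  proof (rule ccontr)
    assume "\<not> 3 \<le> length v"
    then consider "v = []" | a where "v = [a]" | a b where "v = [a, b]"
      by (cases v; cases "tl v"; cases "tl (tl v)") auto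
    then show False
    proof cases
      case 1
      then show ?thesis using e by simp
    next
      case (2 a)
      then have "a \<in> product_generators" using v by simp
      then show ?thesis
        using e unfolding 2 by (elim insertE emptyE) (simp_all add: quaternion_mult_def)
    next
      case (3 a b)
      then have "a \<in> product_generators" "b \<in> product_generators" using v by simp_all
      then show ?thesis
        using e unfolding 3 by (elim insertE emptyE) (simp_all add: quaternion_mult_def)
    qed
  qed
  then have "[(2, 0), (4, 1), (3, 0)] \<in> ?L"
    unfolding iff eval by (simp add: numeral_3_eq_3)
  then have "[(2, 0), (3, 0)] \<in> ?L"
    by (rule piecewise_excluding_subseq_closed[OF pe]) simp
  \<comment> \<open>Deleting b leaves a a^-1, which represents the identity, so the empty word is a
    shorter competitor.\<close>
  then have "foldr (\<otimes>\<^bsub>?P\<^esub>) [] \<one>\<^bsub>?P\<^esub> = foldr (\<otimes>\<^bsub>?P\<^esub>) [(2, 0), (3, 0)] \<one>\<^bsub>?P\<^esub> \<longrightarrow>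
      length [(2, 0), (3, 0) :: nat \<times> nat] \<le> length ([] :: (nat \<times> nat) list)"
    unfolding iff using lists.Nil by blast
  then show False
    by (simp add: quaternion_mult_def)
qed

theorem proposition3p8:
  shows "\<exists>(G\<^sub>1 :: nat monoid) (G\<^sub>2 :: nat monoid).
    piecewise_excluding_group G\<^sub>1 \<and> piecewise_excluding_group G\<^sub>2 \<and>
    \<not> piecewise_excluding_group (G\<^sub>1 \<times>\<times> G\<^sub>2)"
proof (intro exI conjI)
  show "piecewise_excluding_group quaternion_group"
    by (rule piecewise_excluding_group_quaternion)
  show "piecewise_excluding_group cyclic_group_3"
    by (rule piecewise_excluding_group_cyclic_3)
  have "finite product_generators" by simp
  then show "\<not> piecewise_excluding_group (quaternion_group \<times>\<times> cyclic_group_3)"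
    using symmetric_generating_set_product not_piecewise_excluding_product
    unfolding piecewise_excluding_group_def by metis
qed

end
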